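(* Let $\mathcal R$ be a commutative ELT ring and let $A\in(\overline{\mathcal R})^{n\times n}$. If $\det(A)$ is invertible in $\mathcal R$, then $A$ is quasi-invertible.
   Context: Let $F$ be a totally ordered abelian group (written additively) and $L$ a commutative ring with $1\neq 0$. The commutative ELT ring $\mathcal R=\mathscr R(L,F)$ is the set of symbols ${}^{[\ell]}a$ ($a\in F$, $\ell\in L$) with multiplication ${}^{[\ell_1]}a_1\cdot{}^{[\ell_2]}a_2={}^{[\ell_1\ell_2]}(a_1+a_2)$ and addition ${}^{[\ell_1]}a_1+{}^{[\ell_2]}a_2$ equal to ${}^{[\ell_1]}a_1$ if $a_1>a_2$, to ${}^{[\ell_2]}a_2$ if $a_1<a_2$, and to ${}^{[\ell_1+\ell_2]}a_1$ if $a_1=a_2$. The layer of ${}^{[\ell]}a$ is $s({}^{[\ell]}a)=\ell$. Set $\overline{\mathcal R}=\mathcal R\cup\{-\infty\}$, where $-\infty+\alpha=\alpha+(-\infty)=\alpha$, $-\infty\cdot\alpha=\alpha\cdot(-\infty)=-\infty$ and $s(-\infty)=0$; this is a commutative semiring with zero $-\infty$ and unit ${}^{[1]}0$. Matrices over $\overline{\mathcal R}$ are multiplied as usual, and $\det(A)=\sum_{\sigma\in S_n}{}^{[\operatorname{sgn}\sigma]}0\cdot a_{1,\sigma(1)}\cdots a_{n,\sigma(n)}$. A matrix is nonsingular if the layer of its determinant is nonzero. A quasi-identity matrix is a matrix $\tilde I\in(\overline{\mathcal R})^{n\times n}$ which is idempotent ($\tilde I^2=\tilde I$), nonsingular, has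 all diagonal entries equal to ${}^{[1]}0$, and has all off-diagonal entries $\alpha_{i,j}\in\overline{\mathcal R}$ of layer $s(\alpha_{i,j})=0$. A matrix $B\in(\overline{\mathcal R})^{n\times n}$ is a quasi-inverse of $A$ if $AB$ and $BA$ are both quasi-identity matrices ($AB$ and $BA$ may differ); $A$ is quasi-invertible if it has a quasi-inverse. *)

theory Defs
  imports "HOL-Analysis.Analysis"
begin

text \<open>
  The type \<open>('l, 'f) elt\<close> is the semiring obtained from the ELT ring over the layer
  ring \<open>'l\<close> and the value group \<open>'f\<close> by adjoining \<open>-\<infinity>\<close>:
  \<open>Elt l a\<close> is the symbol with layer \<open>l\<close> and value \<open>a\<close>.
\<close>

datatype ('l, 'f) elt = MInf | Elt 'l 'f

text \<open>The ELT ring itself, without \<open>-\<infinity>\<close>.\<close>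

definition elt_ring :: "('l, 'f) elt set" where
  "elt_ring = range (\<lambda>(l, a). Elt l a)"

fun layer :: "('l::zero, 'f) elt \<Rightarrow> 'l" where
  "layer MInf = 0"
| "layer (Elt l a) = l"

instantiation elt :: (comm_ring_1, linordered_ab_group_add) comm_semiring_1
begin

definition zero_elt :: "('a, 'b) elt" where
  "zero_elt = MInf"

definition one_elt :: "('a, 'b) elt" where
  "one_elt = Elt 1 0"

fun plus_elt :: "('a, 'b) elt \<Rightarrow> ('a, 'b) elt \<Rightarrow> ('a, 'b) elt" where
  "plus_elt MInf y = y"
| "plus_elt (Elt l a) MInf = Elt l a"
| "plus_elt (Elt l a) (Elt m b) =
     (if a > b then Elt l a else if a < b then Elt m b else Elt (l + m) a)"

fun times_elt :: "('a, 'b) elt \<Rightarrow> ('a, 'b) elt \<Rightarrow> ('a, 'b) elt" where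
  "times_elt MInf y = MInf"
| "times_elt (Elt l a) MInf = MInf"
| "times_elt (Elt l a) (Elt m b) = Elt (l * m) (a + b)"

instance
proof
  fix x y z :: "('a, 'b) elt"
  show "x + y + z = x + (y + z)"
    by (cases x; cases y; cases z) (auto simp: add.assoc)
  show "x + y = y + x"
    by (cases x; cases y) (auto simp: add.commute)
  show "0 + x = x"
    by (simp add: zero_elt_def)
  show "x * y * z = x * (y * z)"
    by (cases x; cases y; cases z) (auto simp: ac_simps)
  show "x * y = y * x"
    by (cases x; cases y) (auto simp: ac_simps)
  show "1 * x = x"
    by (cases x) (auto simp: one_elt_def)
  show "(x + y) * z = x * z + y * z"
    by (cases x; cases y; cases z) (auto simp: distrib_right)
  show "0 * x = 0" "x * 0 = 0"
    by (cases x; simp add: zero_elt_def)+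
  show "(0 :: ('a, 'b) elt) \<noteq> 1"
    by (simp add: zero_elt_def one_elt_def)
qed

end

text \<open>
  The library determinant needs additive inverses, which are not available here; the sign
  of a permutation enters as a layer.
\<close>

definition elt_det :: "('l::comm_ring_1, 'f::linordered_ab_group_add) elt ^'n^'n \<Rightarrow> ('l, 'f) elt" where
  "elt_det A =
     (\<Sum>p | p permutes (UNIV :: 'n set). Elt (of_int (sign p)) 0 * (\<Prod>i\<in>UNIV. A $ i $ p i))"

definition elt_nonsingular :: "('l::comm_ring_1, 'f::linordered_ab_group_add) elt ^'n^'n \<Rightarrow> bool" where
  "elt_nonsingular A \<longleftrightarrow> layer (elt_det A) \<noteq> 0"

definition elt_invertible :: "('l::comm_ring_1, 'f::linordered_ab_group_add) elt \<Rightarrow> bool" where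
  "elt_invertible x \<longleftrightarrow> x \<in> elt_ring \<and> (\<exists>y\<in>elt_ring. x * y = 1)"

definition quasi_identity :: "('l::comm_ring_1, 'f::linordered_ab_group_add) elt ^'n^'n \<Rightarrow> bool" where
  "quasi_identity E \<longleftrightarrow>
     E ** E = E \<and>
     elt_nonsingular E \<and>
     (\<forall>i. E $ i $ i = 1) \<and>
     (\<forall>i j. i \<noteq> j \<longrightarrow> layer (E $ i $ j) = 0)"

definition quasi_inverse ::
  "('l::comm_ring_1, 'f::linordered_ab_group_add) elt ^'n^'n \<Rightarrow> ('l, 'f) elt ^'n^'n \<Rightarrow> bool" where
  "quasi_inverse A B \<longleftrightarrow> quasi_identity (A ** B) \<and> quasi_identity (B ** A)"

definition quasi_invertible :: "('l::comm_ring_1, 'f::linordered_ab_group_add) elt ^'n^'n \<Rightarrow> bool" where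
  "quasi_invertible A \<longleftrightarrow> (\<exists>B. quasi_inverse A B)"

end

theory Submission
  imports Defs
begin

text \<open>
  Let \<open>u\<close> be the inverse of \<open>det A\<close>. As over a ring, the candidate is the scaled adjugate
  \<open>B = u \<cdot> adj A\<close>, and expanding along row \<open>k\<close> shows that the \<open>(i, k)\<close> entry of \<open>E = A B\<close> is
  \<open>u\<close> times the determinant of \<open>A\<close> with row \<open>k\<close> replaced by row \<open>i\<close>. For \<open>i = k\<close> this is \<open>1\<close>;
  for \<open>i \<noteq> k\<close> the terms of the determinant cancel in pairs, which leaves an element of layer
  \<open>0\<close>, but usually not the zero of the semiring.

  An element of layer \<open>0\<close> is absorbed by any summand of at least its value. Therefore both
  idempotency and nonsingularity of \<open>E\<close> follow from the triangle inequality
  \<open>E\<^sub>i\<^sub>k E\<^sub>k\<^sub>j \<le> E\<^sub>i\<^sub>j\<close> between values (\<open>quasi_identityI\<close>): in \<open>(E\<^sup>2)\<^sub>i\<^sub>j\<close> the term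
  \<open>E\<^sub>i\<^sub>i E\<^sub>i\<^sub>j = E\<^sub>i\<^sub>j\<close> absorbs the others, and in \<open>det E\<close> the term of the identity, which is \<open>1\<close>,
  absorbs the others.

  Up to layers the triangle inequality is a statement about products of entries of \<open>A\<close>
  (\<open>val_le_elt_det_exchange\<close>). A term of the determinant for \<open>E\<^sub>i\<^sub>k\<close> multiplied by one for
  \<open>E\<^sub>k\<^sub>j\<close> uses every column twice, and every row twice except for one additional use of row \<open>i\<close>
  and one missing use of row \<open>j\<close>. Such a product can be regrouped into a term of \<open>det A\<close>
  and a term of the determinant for \<open>E\<^sub>i\<^sub>j\<close> (\<open>exchange_permutations\<close>): regard each column as an
  edge joining the two rows used in it; a balanced orientation of this graph
  (\<open>balanced_orientation\<close>) says which of the two rows goes to which factor.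

  For \<open>B A\<close> transpose everything: the scaled adjugate and the class of quasi-identities are
  compatible with transposition.
\<close>

section \<open>Balanced orientations and exchange of permutations\<close>

text \<open>
  The edges of a finite multigraph are indexed by \<open>C\<close>, with \<open>c\<close> joining \<open>f c\<close> to \<open>g c\<close>, and
  \<open>\<sigma> c\<close> says whether this direction of the edge is kept or reversed; the sum is then the
  difference of out-degree and in-degree at \<open>v\<close>. The proof is by splitting off: two edges that meet in a
  vertex are merged into a single edge joining their other ends, and an orientation of the merged
  edge lifts to a walk through the common vertex, which does not change the
  differences. When no two edges meet, every orientation is balanced.
\<close>

lemma balanced_orientation:
  fixes f g :: "'c \<Rightarrow> 'v"
  assumes "finite C"
  shows "\<exists>\<sigma>::'c \<Rightarrow> int. (\<forall>c. \<sigma> c = 1 \<or> \<sigma> c = -1) \<and>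
    (\<forall>v. \<bar>\<Sum>c\<in>C. \<sigma> c * (of_bool (f c = v) - of_bool (g c = v))\<bar> \<le> 1)"
  using assms
proof (induction C arbitrary: f g rule: finite_psubset_induct)
  case (psubset C)
  let ?D = "\<lambda>f g c v. of_bool (f c = v) - of_bool (g c = v) :: int"
  show ?case
  proof (cases "\<exists>c\<in>C. \<exists>d\<in>C. c \<noteq> d \<and> {f c, g c} \<inter> {f d, g d} \<noteq> {}")
    case True
    then obtain c d where cd: "c \<in> C" "d \<in> C" "c \<noteq> d"
      and meet: "f c = f d \<or> f c = g d \<or> g c = f d \<or> g c = g d" by auto
    \<comment> \<open>The merged edge from \<open>a\<close> to \<open>b\<close>; \<open>\<epsilon>\<close> is \<open>-1\<close> if \<open>d\<close> must be reversed to
      continue the walk along \<open>c\<close>.\<close>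
    have "\<exists>\<epsilon> a b. (\<epsilon> = 1 \<or> \<epsilon> = -1) \<and>
        (\<forall>v. ?D f g c v + \<epsilon> * ?D f g d v = of_bool (a = v) - of_bool (b = v))"
      using meet
    proof (elim disjE)
      assume "f c = f d"
      then show ?thesis
        by (intro exI[of _ "-1"] exI[of _ "g d"] exI[of _ "g c"]) auto
    next
      assume "f c = g d"
      then show ?thesis
        by (intro exI[of _ 1] exI[of _ "f d"] exI[of _ "g c"]) auto
    next
      assume "g c = f d"
      then show ?thesis
        by (intro exI[of _ 1] exI[of _ "f c"] exI[of _ "g d"]) auto
    next
      assume "g c = g d"
      then show ?thesis
        by (intro exI[of _ "-1"] exI[of _ "f c"] exI[of _ "f d"]) auto
    qed
    then obtain \<epsilon> a b where \<epsilon>: "\<epsilon> = 1 \<or> \<epsilon> = -1"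
      and merge: "\<And>v. ?D f g c v + \<epsilon> * ?D f g d v = of_bool (a = v) - of_bool (b = v)" by blast
    have "C - {d} \<subset> C" using cd by auto
    from psubset.IH[OF this, of "f(c := a)" "g(c := b)"] obtain \<sigma> :: "'c \<Rightarrow> int"
      where \<sigma>: "\<And>x. \<sigma> x = 1 \<or> \<sigma> x = -1"
        and bal: "\<And>v. \<bar>\<Sum>x\<in>C - {d}. \<sigma> x * ?D (f(c := a)) (g(c := b)) x v\<bar> \<le> 1"
      by blast
    let ?\<tau> = "\<sigma>(d := \<epsilon> * \<sigma> c)"
    have "(\<Sum>x\<in>C. ?\<tau> x * ?D f g x v) =
        (\<Sum>x\<in>C - {d}. \<sigma> x * ?D (f(c := a)) (g(c := b)) x v)" for v
    proof -
      have fin: "finite C" "finite (C - {d})" using psubset.hyps by auto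
      have c: "c \<in> C - {d}" using cd by simp
      have "(\<Sum>x\<in>C. ?\<tau> x * ?D f g x v) =
          \<epsilon> * \<sigma> c * ?D f g d v + (\<Sum>x\<in>C - {d}. ?\<tau> x * ?D f g x v)"
        using sum.remove[OF fin(1) cd(2), of "\<lambda>x. ?\<tau> x * ?D f g x v"] by simp
      also have "(\<Sum>x\<in>C - {d}. ?\<tau> x * ?D f g x v) =
          \<sigma> c * ?D f g c v + (\<Sum>x\<in>C - {d} - {c}. ?\<tau> x * ?D f g x v)"
        using sum.remove[OF fin(2) c, of "\<lambda>x. ?\<tau> x * ?D f g x v"] cd(3) by simp
      also have "(\<Sum>x\<in>C - {d} - {c}. ?\<tau> x * ?D f g x v) =
          (\<Sum>x\<in>C - {d} - {c}. \<sigma> x * ?D (f(c := a)) (g(c := b)) x v)"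
        by (intro sum.cong) auto
      also have "\<epsilon> * \<sigma> c * ?D f g d v + (\<sigma> c * ?D f g c v + \<dots>) =
          \<sigma> c * (?D f g c v + \<epsilon> * ?D f g d v) + \<dots>"
        by (simp only: algebra_simps)
      also have "\<dots> = (\<Sum>x\<in>C - {d}. \<sigma> x * ?D (f(c := a)) (g(c := b)) x v)"
        unfolding merge
        using sum.remove[OF fin(2) c, of "\<lambda>x. \<sigma> x * ?D (f(c := a)) (g(c := b)) x v"] by simp
      finally show ?thesis .
    qed
    moreover have "?\<tau> x = 1 \<or> ?\<tau> x = -1" for x
      using \<sigma>[of x] \<sigma>[of c] \<epsilon> by auto
    ultimately show ?thesis
      using bal by (intro exI[of _ ?\<tau>]) presburger
  next
    case False
    have "\<bar>\<Sum>c\<in>C. 1 * ?D f g c v\<bar> \<le> 1" for v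
    proof (cases "\<exists>c\<in>C. f c = v \<or> g c = v")
      case True
      then obtain c where c: "c \<in> C" "f c = v \<or> g c = v" by blast
      have "?D f g x v = 0" if "x \<in> C - {c}" for x
        using that c False by auto
      then have "(\<Sum>x\<in>C. 1 * ?D f g x v) = ?D f g c v"
        using sum.remove[OF psubset.hyps(1) c(1), of "\<lambda>x. ?D f g x v"] by simp
      then show ?thesis by simp
    next
      case False
      then have "(\<Sum>c\<in>C. 1 * ?D f g c v) = 0" by (intro sum.neutral) auto
      then show ?thesis by simp
    qed
    then show ?thesis by (intro exI[of _ "\<lambda>_. 1"]) blast
  qed
qed

text \<open>
  The size of a fibre as an integer-valued sum, so that differences of fibre sizes do not
  truncate and are sums over the columns as in \<open>balanced_orientation\<close>.
\<close>

definition fibre :: "('a::finite \<Rightarrow> 'b) \<Rightarrow> 'b \<Rightarrow> int" where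
  "fibre h v = (\<Sum>c\<in>UNIV. of_bool (h c = v))"

lemma fibre_pos: "0 < fibre h v \<longleftrightarrow> v \<in> range h"
proof -
  have "fibre h v = int (card {c. h c = v})"
    unfolding fibre_def of_bool_def by (simp flip: sum.inter_filter)
  then show ?thesis by (auto simp: card_gt_0_iff)
qed

lemma fibre_upd: "fibre (h(c := a)) v = fibre h v - of_bool (h c = v) + of_bool (a = v)"
proof -
  have "fibre h v = of_bool (h c = v) + (\<Sum>x\<in>UNIV - {c}. of_bool (h x = v))" for h :: "'a \<Rightarrow> 'b"
    unfolding fibre_def by (intro sum.remove) auto
  from this[of h] this[of "h(c := a)"] show ?thesis by simp
qed

lemma sum_fibre:
  fixes h :: "'a::finite \<Rightarrow> 'b::finite"
  shows "(\<Sum>v\<in>UNIV. fibre h v) = int CARD('a)"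
  unfolding fibre_def by (subst sum.swap) (simp add: of_bool_def)

lemma fibre_permutes:
  fixes p :: "'a::finite \<Rightarrow> 'a"
  assumes "p permutes UNIV"
  shows "fibre p v = 1"
proof -
  have "fibre p v = (\<Sum>c\<in>UNIV. of_bool (c = v))"
    unfolding fibre_def
    using sum.permute[OF assms, of "\<lambda>c. of_bool (c = v) :: int"] by simp
  then show ?thesis by (simp add: of_bool_def)
qed

text \<open>
  The map \<open>id(k := i) \<circ> p\<close> is the pattern of row uses by column in a determinant term of a
  matrix whose row \<open>k\<close> has been replaced by row \<open>i\<close>. By this lemma and the next one, such
  patterns are recognised by their fibre sizes alone.
\<close>

lemma fibre_redirect_permutes:
  fixes p :: "'a::finite \<Rightarrow> 'a"
  assumes "p permutes UNIV"
  shows "fibre (id(k := i) \<circ> p) v = 1 + of_bool (i = v) - of_bool (k = v)"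
proof -
  have eq: "id(k := i) \<circ> p = p(inv p k := i)"
    using permutes_inverses[OF assms] by (auto simp: fun_eq_iff)
  show ?thesis
    unfolding eq fibre_upd fibre_permutes[OF assms] permutes_inverses(1)[OF assms] by simp
qed

lemma redirect_permutesI:
  fixes h :: "'a::finite \<Rightarrow> 'a"
  assumes "\<And>v. fibre h v = 1 + of_bool (i = v) - of_bool (j = v)"
  shows "\<exists>t. t permutes UNIV \<and> h = id(j := i) \<circ> t"
proof -
  have "fibre h i > 0" using assms[of i] by auto
  then obtain c where c: "h c = i" unfolding fibre_pos by auto
  \<comment> \<open>If \<open>i \<noteq> j\<close>, row \<open>i\<close> is used once too often and row \<open>j\<close> once too rarely, so sending one of the
    columns over \<open>i\<close> to \<open>j\<close> instead leaves a permutation.\<close>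
  let ?t = "h(c := j)"
  have "fibre ?t v = 1" for v unfolding fibre_upd assms c by simp
  then have "v \<in> range ?t" for v unfolding fibre_pos[symmetric] by simp
  then have "surj ?t" by blast
  then have "bij ?t" using finite_UNIV_surj_inj[of ?t] by (simp add: bij_def)
  then have "?t permutes UNIV" by (simp add: permutes_univ bij_iff)
  moreover have "h = id(j := i) \<circ> ?t"
  proof
    fix x
    have "i = j \<or> h x \<noteq> j"
    proof (rule disjCI)
      assume "\<not> h x \<noteq> j"
      then have "fibre h j > 0" unfolding fibre_pos by auto
      then show "i = j" using assms[of j] by (auto split: if_splits)
    qed
    then show "h x = (id(j := i) \<circ> ?t) x" using c by auto
  qed
  ultimately show ?thesis by blast
qed

text \<open>
  Orient the multigraph with an edge from \<open>id(k := i) (p c)\<close> to \<open>id(j := k) (q c)\<close> for every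
  column \<open>c\<close> in a balanced way and collect the tails in one map and the heads in another. All
  vertices other than \<open>i\<close> and \<open>j\<close> have degree two, so both maps hit them exactly once, and the
  same holds for \<open>i\<close> if \<open>i = j\<close>. If \<open>i \<noteq> j\<close>, then \<open>i\<close> has degree three and \<open>j\<close> degree one; as there are as
  many tails as heads, the map that hits \<open>i\<close> twice is the one that misses \<open>j\<close>, and the other
  map is a permutation.
\<close>

lemma exchange_permutations:
  fixes p q :: "'a::finite \<Rightarrow> 'a" and x :: "'a \<Rightarrow> 'a \<Rightarrow> 'm::comm_monoid_mult"
  assumes p: "p permutes UNIV" and q: "q permutes UNIV"
  shows "\<exists>s t. s permutes UNIV \<and> t permutes UNIV \<and>
    (\<Prod>c\<in>UNIV. x ((id(k := i)) (p c)) c) * (\<Prod>c\<in>UNIV. x ((id(j := k)) (q c)) c) =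
    (\<Prod>c\<in>UNIV. x (s c) c) * (\<Prod>c\<in>UNIV. x ((id(j := i)) (t c)) c)"
proof -
  let ?f = "id(k := i) \<circ> p" and ?g = "id(j := k) \<circ> q"
  obtain \<sigma> :: "'a \<Rightarrow> int" where \<sigma>: "\<And>c. \<sigma> c = 1 \<or> \<sigma> c = -1"
    and bal: "\<And>v. \<bar>\<Sum>c\<in>UNIV. \<sigma> c * (of_bool (?f c = v) - of_bool (?g c = v))\<bar> \<le> 1"
    using balanced_orientation[of UNIV ?f ?g] by auto
  define f' where "f' c = (if \<sigma> c = 1 then ?f c else ?g c)" for c
  define g' where "g' c = (if \<sigma> c = 1 then ?g c else ?f c)" for c
  have diff: "\<bar>fibre f' v - fibre g' v\<bar> \<le> 1" for v
  proof -
    have "fibre f' v - fibre g' v =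
        (\<Sum>c\<in>UNIV. \<sigma> c * (of_bool (?f c = v) - of_bool (?g c = v)))"
      unfolding fibre_def sum_subtractf[symmetric]
    proof (intro sum.cong refl)
      fix c show "of_bool (f' c = v) - of_bool (g' c = v) =
          \<sigma> c * (of_bool (?f c = v) - of_bool (?g c = v))"
        using \<sigma>[of c] by (auto simp: f'_def g'_def)
    qed
    then show ?thesis using bal by simp
  qed
  have total: "fibre f' v + fibre g' v = 2 + of_bool (i = v) - of_bool (j = v)" for v
  proof -
    have "fibre f' v + fibre g' v = fibre ?f v + fibre ?g v"
      unfolding fibre_def sum.distrib[symmetric]
      by (intro sum.cong refl) (auto simp: f'_def g'_def)
    then show ?thesis
      unfolding fibre_redirect_permutes[OF p] fibre_redirect_permutes[OF q] by simp
  qed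
  have outside: "fibre f' v = 1 \<and> fibre g' v = 1" if "i = j \<or> v \<noteq> i \<and> v \<noteq> j" for v
  proof -
    have "fibre f' v + fibre g' v = 2" using total[of v] that by auto
    then show ?thesis using diff[of v] by presburger
  qed
  have swapped: "(\<Prod>c\<in>UNIV. x (?f c) c) * (\<Prod>c\<in>UNIV. x (?g c) c) =
      (\<Prod>c\<in>UNIV. x (f' c) c) * (\<Prod>c\<in>UNIV. x (g' c) c)"
    unfolding prod.distrib[symmetric]
    by (intro prod.cong refl) (auto simp: f'_def g'_def mult.commute)
  have split: "(\<forall>v. fibre f' v = 1) \<and> (\<forall>v. fibre g' v = 1 + of_bool (i = v) - of_bool (j = v)) \<or>
      (\<forall>v. fibre g' v = 1) \<and> (\<forall>v. fibre f' v = 1 + of_bool (i = v) - of_bool (j = v))"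
  proof (cases "i = j")
    case True
    then show ?thesis using outside by simp
  next
    case False
    \<comment> \<open>Since \<open>f'\<close> and \<open>g'\<close> have the same domain, their imbalances at \<open>i\<close> and at \<open>j\<close>
      cancel.\<close>
    have "0 = (\<Sum>v\<in>UNIV. fibre f' v - fibre g' v)"
      by (simp add: sum_subtractf sum_fibre)
    also have "\<dots> = (\<Sum>v\<in>{i, j}. fibre f' v - fibre g' v)"
      by (rule sum.mono_neutral_right) (auto simp: outside)
    finally have "fibre f' i - fibre g' i + (fibre f' j - fibre g' j) = 0"
      using False by simp
    moreover have "fibre f' i = 1 \<and> fibre g' i = 2 \<or> fibre f' i = 2 \<and> fibre g' i = 1"
    proof -
      have "fibre f' i + fibre g' i = 3" using total[of i] False by simp
      then show ?thesis using diff[of i] by linarith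
    qed
    moreover have "fibre f' j = 1 \<and> fibre g' j = 0 \<or> fibre f' j = 0 \<and> fibre g' j = 1"
    proof -
      have "fibre f' j + fibre g' j = 1" using total[of j] False by simp
      then show ?thesis using diff[of j] by linarith
    qed
    ultimately have "fibre f' i = 1 \<and> fibre g' i = 2 \<and> fibre f' j = 1 \<and> fibre g' j = 0 \<or>
        fibre f' i = 2 \<and> fibre g' i = 1 \<and> fibre f' j = 0 \<and> fibre g' j = 1"
      by linarith
    then show ?thesis
    proof (rule disj_forward)
      assume at: "fibre f' i = 1 \<and> fibre g' i = 2 \<and> fibre f' j = 1 \<and> fibre g' j = 0"
      have "fibre f' v = 1 \<and> fibre g' v = 1 + of_bool (i = v) - of_bool (j = v)" for v
        using at outside[of v] False by (cases "v = i"; cases "v = j") simp_all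
      then show "(\<forall>v. fibre f' v = 1) \<and> (\<forall>v. fibre g' v = 1 + of_bool (i = v) - of_bool (j = v))"
        by blast
    next
      assume at: "fibre f' i = 2 \<and> fibre g' i = 1 \<and> fibre f' j = 0 \<and> fibre g' j = 1"
      have "fibre g' v = 1 \<and> fibre f' v = 1 + of_bool (i = v) - of_bool (j = v)" for v
        using at outside[of v] False by (cases "v = i"; cases "v = j") simp_all
      then show "(\<forall>v. fibre g' v = 1) \<and> (\<forall>v. fibre f' v = 1 + of_bool (i = v) - of_bool (j = v))"
        by blast
    qed
  qed
  have realise: "\<exists>s t. s permutes UNIV \<and> t permutes UNIV \<and> h = s \<and> h' = id(j := i) \<circ> t"
    if "\<forall>v. fibre h v = 1" "\<forall>v. fibre h' v = 1 + of_bool (i = v) - of_bool (j = v)" for h h' :: "'a \<Rightarrow> 'a"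
  proof -
    have "\<exists>s. s permutes UNIV \<and> h = id(i := i) \<circ> s"
      using that(1) by (intro redirect_permutesI) simp
    moreover have "id(i := i) = id" by auto
    moreover have "\<exists>t. t permutes UNIV \<and> h' = id(j := i) \<circ> t"
      using that(2) by (intro redirect_permutesI) simp
    ultimately show ?thesis by (metis id_comp)
  qed
  from split show ?thesis
  proof (elim disjE conjE)
    assume "\<forall>v. fibre f' v = 1" "\<forall>v. fibre g' v = 1 + of_bool (i = v) - of_bool (j = v)"
    from realise[OF this] obtain s t where "s permutes UNIV" "t permutes UNIV"
      "f' = s" "g' = id(j := i) \<circ> t" by blast
    then show ?thesis
      using swapped by (intro exI[of _ s] exI[of _ t]) simp
  next
    assume "\<forall>v. fibre g' v = 1" "\<forall>v. fibre f' v = 1 + of_bool (i = v) - of_bool (j = v)"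
    from realise[OF this] obtain s t where "s permutes UNIV" "t permutes UNIV"
      "g' = s" "f' = id(j := i) \<circ> t" by blast
    then show ?thesis
      using swapped by (intro exI[of _ s] exI[of _ t]) (simp add: mult.commute)
  qed
qed

section \<open>Comparing values\<close>

text \<open>
  Multiplication by this idempotent forgets the layer and keeps the value. Its multiples
  form a copy of the max-plus semiring, so values can be compared by semiring
  identities, without reference to \<open>MInf\<close>.
\<close>

definition ghost :: "('l::comm_ring_1, 'f::linordered_ab_group_add) elt" where
  "ghost = Elt 0 0"

definition val_le :: "('l::comm_ring_1, 'f::linordered_ab_group_add) elt \<Rightarrow> ('l, 'f) elt \<Rightarrow> bool" where
  "val_le x y \<longleftrightarrow> ghost * x + ghost * y = ghost * y"

lemma ghost_idem: "ghost * ghost = ghost" "ghost + ghost = ghost"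
  by (simp_all add: ghost_def)

lemma ghost_unit: "ghost * Elt l 0 = ghost"
  by (simp add: ghost_def)

lemma layer_zero_iff: "layer x = 0 \<longleftrightarrow> ghost * x = x"
  by (cases x) (auto simp: ghost_def)

lemma layer_one: "layer 1 = 1"
  by (simp add: one_elt_def)

lemma val_le_refl: "val_le x x"
  unfolding val_le_def by (simp add: ghost_idem flip: distrib_right)

lemma val_le_trans: "val_le x y \<Longrightarrow> val_le y z \<Longrightarrow> val_le x z"
  unfolding val_le_def by (metis add.assoc)

lemma val_le_mult_right:
  assumes "val_le x y"
  shows "val_le (x * z) (y * z)"
proof -
  have "(ghost * x + ghost * y) * z = ghost * y * z"
    using assms unfolding val_le_def by (rule arg_cong)
  then show ?thesis unfolding val_le_def by (simp only: distrib_right mult.assoc)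
qed

lemma val_le_mult:
  assumes "val_le x x'" "val_le y y'"
  shows "val_le (x * y) (x' * y')"
proof (rule val_le_trans)
  show "val_le (x * y) (x' * y)" using assms(1) by (rule val_le_mult_right)
  show "val_le (x' * y) (x' * y')"
    using val_le_mult_right[OF assms(2), of x'] by (simp only: mult.commute)
qed

lemma val_le_zero: "val_le 0 x"
  unfolding val_le_def by simp

lemma val_le_sum:
  assumes "\<And>a. a \<in> S \<Longrightarrow> val_le (f a) z"
  shows "val_le (sum f S) z"
  using assms
proof (induction S rule: infinite_finite_induct)
  case (insert a S)
  then have "val_le (f a) z" "val_le (sum f S) z" by auto
  then show ?case
    using insert.hyps unfolding val_le_def by (simp add: distrib_left add.assoc)
qed (simp_all add: val_le_zero)

lemma val_le_member:
  assumes "finite S" "a \<in> S"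
  shows "val_le (f a) (sum f S)"
proof -
  have "ghost * f a + ghost * f a = ghost * f a"
    using val_le_refl[of "f a"] unfolding val_le_def .
  then show ?thesis
    unfolding val_le_def sum.remove[OF assms]
    by (simp add: distrib_left flip: add.assoc)
qed

text \<open>
  Signs of permutations are layers of value \<open>0\<close>, so this removes them from comparisons.
\<close>

lemma val_le_layer: "val_le (Elt l 0 * x) y \<longleftrightarrow> val_le x y" "val_le x (Elt l 0 * y) \<longleftrightarrow> val_le x y"
  unfolding val_le_def by (simp_all add: ghost_unit flip: mult.assoc)

text \<open>
  At equal values the layers are added, so a summand of layer \<open>0\<close> changes nothing; at a
  smaller value it is discarded.
\<close>

lemma absorb:
  assumes "layer x = 0" "val_le x y"
  shows "y + x = y"
  using assms by (cases x; cases y) (auto simp: val_le_def ghost_def split: if_splits)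

lemma absorb_sum:
  assumes "finite S" "\<And>a. a \<in> S \<Longrightarrow> layer (f a) = 0" "\<And>a. a \<in> S \<Longrightarrow> val_le (f a) y"
  shows "y + sum f S = y"
proof (rule absorb)
  show "layer (sum f S) = 0"
    using assms(2) unfolding layer_zero_iff by (simp add: sum_distrib_left)
  show "val_le (sum f S) y" using assms(3) by (rule val_le_sum)
qed

lemma layer_mult_eq_0: "layer x = 0 \<Longrightarrow> layer (x * y) = 0"
  unfolding layer_zero_iff by (simp flip: mult.assoc)

section \<open>Determinants with a replaced row\<close>

definition replace_row :: "'a ^'n^'n \<Rightarrow> 'n \<Rightarrow> 'a ^'n \<Rightarrow> 'a ^'n^'n" where
  "replace_row A k v = (\<chi> r. if r = k then v else A $ r)"

lemma elt_det_columns: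
  fixes A :: "('l::comm_ring_1, 'f::linordered_ab_group_add) elt ^'n^'n"
  shows "elt_det A =
    (\<Sum>p | p permutes (UNIV :: 'n set). Elt (of_int (sign p)) 0 * (\<Prod>c\<in>UNIV. A $ p c $ c))"
proof -
  have "elt_det A = (\<Sum>p | p permutes (UNIV :: 'n set).
      Elt (of_int (sign (inv p))) 0 * (\<Prod>r\<in>UNIV. A $ r $ inv p r))"
    unfolding elt_det_def by (rule sum_permutations_inverse)
  also have "\<dots> = (\<Sum>p | p permutes (UNIV :: 'n set).
      Elt (of_int (sign p)) 0 * (\<Prod>c\<in>UNIV. A $ p c $ c))"
  proof (intro sum.cong refl)
    fix p :: "'n \<Rightarrow> 'n" assume "p \<in> {p. p permutes UNIV}"
    then have p: "p permutes UNIV" by simp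
    have "(\<Prod>r\<in>UNIV. A $ r $ inv p r) = (\<Prod>c\<in>UNIV. A $ p c $ c)"
      using prod.permute[OF p, of "\<lambda>r. A $ r $ inv p r"] permutes_inverses[OF p] by simp
    moreover have "permutation p" using p by (simp add: permutation_permutes exI[of _ UNIV])
    ultimately show "Elt (of_int (sign (inv p))) 0 * (\<Prod>r\<in>UNIV. A $ r $ inv p r) =
        Elt (of_int (sign p)) 0 * (\<Prod>c\<in>UNIV. A $ p c $ c)"
      by (simp add: sign_inverse)
  qed
  finally show ?thesis .
qed

lemma transpose_nth: "transpose A $ i $ j = A $ j $ i"
  by (simp add: transpose_def)

lemma elt_det_transpose: "elt_det (transpose A) = elt_det A"
  unfolding elt_det_columns[of A] unfolding elt_det_def by (simp add: transpose_def)

lemma replace_row_self: "replace_row A k (A $ k) = A"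
  by (simp add: replace_row_def vec_eq_iff)

lemma elt_det_replace_row_expand:
  fixes A :: "('l::comm_ring_1, 'f::linordered_ab_group_add) elt ^'n^'n"
  shows "elt_det (replace_row A k v) = (\<Sum>j\<in>UNIV. v $ j * elt_det (replace_row A k (axis j 1)))"
proof -
  let ?w = "\<lambda>p. Elt (of_int (sign p)) 0 * (\<Prod>r\<in>UNIV - {k}. A $ r $ p r)"
  have *: "elt_det (replace_row A k u) = (\<Sum>p | p permutes (UNIV :: 'n set). u $ p k * ?w p)" for u
    unfolding elt_det_def
  proof (intro sum.cong refl)
    fix p :: "'n \<Rightarrow> 'n"
    have "(\<Prod>r\<in>UNIV. replace_row A k u $ r $ p r) =
        u $ p k * (\<Prod>r\<in>UNIV - {k}. replace_row A k u $ r $ p r)"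
      by (subst prod.remove[of _ k]) (simp_all add: replace_row_def)
    also have "(\<Prod>r\<in>UNIV - {k}. replace_row A k u $ r $ p r) = (\<Prod>r\<in>UNIV - {k}. A $ r $ p r)"
      by (intro prod.cong) (auto simp: replace_row_def)
    finally show "Elt (of_int (sign p)) 0 * (\<Prod>r\<in>UNIV. replace_row A k u $ r $ p r) = u $ p k * ?w p"
      by (simp only: mult.left_commute)
  qed
  have "(\<Sum>j\<in>UNIV. v $ j * elt_det (replace_row A k (axis j 1))) =
      (\<Sum>p | p permutes (UNIV :: 'n set). \<Sum>j\<in>UNIV. v $ j * (axis j 1 $ p k * ?w p))"
    unfolding * sum_distrib_left by (rule sum.swap)
  also have "\<dots> = (\<Sum>p | p permutes (UNIV :: 'n set). v $ p k * ?w p)"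
  proof (intro sum.cong refl)
    fix p :: "'n \<Rightarrow> 'n"
    have "(\<Sum>j\<in>UNIV. v $ j * (axis j 1 $ p k * ?w p)) =
        (\<Sum>j\<in>UNIV. if j = p k then v $ j * ?w p else 0)"
      by (intro sum.cong refl) (auto simp: axis_def)
    then show "(\<Sum>j\<in>UNIV. v $ j * (axis j 1 $ p k * ?w p)) = v $ p k * ?w p" by simp
  qed
  finally show ?thesis unfolding * by simp
qed

text \<open>
  Both sides are the signed cofactor of the entry \<open>(j, i)\<close> of \<open>A\<close>: only the permutations with
  \<open>p j = i\<close> contribute, and for those the two products agree factor by factor.
\<close>

lemma elt_det_unit_row_transpose:
  fixes A :: "('l::comm_ring_1, 'f::linordered_ab_group_add) elt ^'n^'n"
  shows "elt_det (replace_row (transpose A) i (axis j 1)) = elt_det (replace_row A j (axis i 1))"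
  unfolding elt_det_columns[of "replace_row (transpose A) i (axis j 1)"]
  unfolding elt_det_def
proof (intro sum.cong refl arg_cong2[where f = "(*)"])
  fix p :: "'n \<Rightarrow> 'n" assume "p \<in> {p. p permutes UNIV}"
  then have p: "p permutes UNIV" by simp
  show "(\<Prod>c\<in>UNIV. replace_row (transpose A) i (axis j 1) $ p c $ c) =
      (\<Prod>r\<in>UNIV. replace_row A j (axis i 1) $ r $ p r)"
  proof (cases "p j = i")
    case True
    then have "p c = i \<longleftrightarrow> c = j" for c using permutes_inj[OF p] by (auto dest: injD)
    then show ?thesis
      by (intro prod.cong refl) (auto simp: replace_row_def transpose_def axis_def)
  next
    case False
    have "replace_row A j (axis i 1) $ j $ p j = 0"
      using False by (simp add: replace_row_def axis_def)
    then have "(\<Prod>r\<in>UNIV. replace_row A j (axis i 1) $ r $ p r) = 0"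
      by (subst prod.remove[of _ j]) auto
    moreover have "replace_row (transpose A) i (axis j 1) $ p (inv p i) $ inv p i = 0"
      using False permutes_inverses[OF p] by (auto simp: replace_row_def axis_def)
    then have "(\<Prod>c\<in>UNIV. replace_row (transpose A) i (axis j 1) $ p c $ c) = 0"
      by (subst prod.remove[of _ "inv p i"]) auto
    ultimately show ?thesis by simp
  qed
qed

text \<open>
  Exchanging the equal rows matches each even permutation with an odd one whose term is the same
  up to sign. Two matched terms add up to a multiple of \<open>1 + Elt (-1) 0 = ghost\<close>, so the whole
  determinant is such a multiple.
\<close>

lemma layer_elt_det_equal_rows:
  fixes A :: "('l::comm_ring_1, 'f::linordered_ab_group_add) elt ^'n^'n"
  assumes "i \<noteq> k" and eq: "A $ i = A $ k"
  shows "layer (elt_det A) = 0"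
proof -
  let ?P = "{p. p permutes (UNIV :: 'n set)}"
  let ?E = "{p \<in> ?P. evenperm p}" and ?O = "{p \<in> ?P. \<not> evenperm p}"
  let ?\<tau> = "Transposition.transpose i k"
  let ?m = "\<lambda>p. \<Prod>r\<in>UNIV. A $ r $ p r"
  have \<tau>: "?\<tau> permutes UNIV" by (rule permutes_swap_id) auto
  have perm: "permutation p" if "p \<in> ?P" for p
    using that by (auto simp: permutation_permutes)
  have even_comp: "evenperm (p \<circ> ?\<tau>) \<longleftrightarrow> \<not> evenperm p" if "p \<in> ?P" for p
    using evenperm_comp[OF perm[OF that] permutation_swap_id] assms(1) evenperm_swap[of i k] by simp
  have m_comp: "?m (p \<circ> ?\<tau>) = ?m p" for p
  proof -
    have row: "A $ ?\<tau> r = A $ r" for r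
      unfolding Transposition.transpose_def by (simp add: eq)
    have "?m p = (\<Prod>r\<in>UNIV. A $ ?\<tau> r $ p (?\<tau> r))"
      using prod.permute[OF \<tau>, of "\<lambda>r. A $ r $ p r"] by (simp only: comp_def)
    also have "\<dots> = ?m (p \<circ> ?\<tau>)" by (simp only: row comp_def)
    finally show ?thesis ..
  qed
  have bij: "bij_betw (\<lambda>p. p \<circ> ?\<tau>) ?E ?O"
    by (rule bij_betw_byWitness[where f' = "\<lambda>p. p \<circ> ?\<tau>"])
       (auto simp: even_comp permutes_compose[OF \<tau>] comp_assoc)
  have "elt_det A = (\<Sum>p\<in>?E. Elt (of_int (sign p)) 0 * ?m p) + (\<Sum>p\<in>?O. Elt (of_int (sign p)) 0 * ?m p)"
    unfolding elt_det_def
    by (subst sum.union_disjoint[symmetric]) (auto intro!: sum.cong)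
  also have "(\<Sum>p\<in>?E. Elt (of_int (sign p)) 0 * ?m p) = (\<Sum>p\<in>?E. Elt 1 0 * ?m p)"
    by (intro sum.cong refl) (auto simp: sign_def)
  also have "(\<Sum>p\<in>?O. Elt (of_int (sign p)) 0 * ?m p) = (\<Sum>p\<in>?O. Elt (-1) 0 * ?m p)"
    by (intro sum.cong refl) (auto simp: sign_def)
  also have "\<dots> = (\<Sum>p\<in>?E. Elt (-1) 0 * ?m p)"
    unfolding sum.reindex_bij_betw[OF bij, of "\<lambda>p. Elt (-1) 0 * ?m p", symmetric] m_comp ..
  also have "(\<Sum>p\<in>?E. Elt 1 0 * ?m p) + (\<Sum>p\<in>?E. Elt (-1) 0 * ?m p) = ghost * (\<Sum>p\<in>?E. ?m p)"
    by (simp add: ghost_def sum_distrib_left flip: sum.distrib distrib_right)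
  finally show ?thesis
    unfolding layer_zero_iff by (simp add: ghost_idem flip: mult.assoc)
qed

text \<open>
  Multiply out the left-hand side. Apart from signs, each product of two terms is
  regrouped by \<open>exchange_permutations\<close> into a product of two terms from the right-hand side, and
  a term never exceeds the sum in value, because values are not lowered by cancellation of
  layers.
\<close>

lemma val_le_elt_det_exchange:
  fixes A :: "('l::comm_ring_1, 'f::linordered_ab_group_add) elt ^'n^'n"
  shows "val_le (elt_det (replace_row A k (A $ i)) * elt_det (replace_row A j (A $ k)))
    (elt_det A * elt_det (replace_row A j (A $ i)))"
proof -
  let ?P = "{p. p permutes (UNIV :: 'n set)}"
  let ?m = "\<lambda>k i p. \<Prod>c\<in>UNIV. A $ (id(k := i)) (p c) $ c"
  let ?s = "\<lambda>p. Elt (of_int (sign p)) 0 :: ('l, 'f) elt"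
  have det: "elt_det (replace_row A k (A $ i)) = (\<Sum>p\<in>?P. ?s p * ?m k i p)" for k i
    unfolding elt_det_columns
    by (intro sum.cong refl arg_cong2[where f = "(*)"] prod.cong) (auto simp: replace_row_def)
  have le: "val_le (?m k i p) (elt_det (replace_row A k (A $ i)))" if "p \<in> ?P" for k i p
    using val_le_member[of ?P p "\<lambda>p. ?s p * ?m k i p"] that
    by (simp add: det val_le_layer finite_permutations)
  have A: "elt_det A = elt_det (replace_row A i (A $ i))" by (simp add: replace_row_self)
  show ?thesis
    unfolding det[of k i] det[of j k] sum_product
  proof (intro val_le_sum)
    fix p q assume "p \<in> ?P" "q \<in> ?P"
    then obtain s t where st: "s \<in> ?P" "t \<in> ?P"
      and eq: "?m k i p * ?m j k q = (\<Prod>c\<in>UNIV. A $ s c $ c) * ?m j i t"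
      using exchange_permutations[of p q "\<lambda>r c. A $ r $ c" k i j] by auto
    have "(\<Prod>c\<in>UNIV. A $ s c $ c) = ?m i i s" by (intro prod.cong) auto
    with eq have "val_le (?m k i p * ?m j k q) (elt_det A * elt_det (replace_row A j (A $ i)))"
      unfolding A using val_le_mult[OF le[OF st(1), of i i] le[OF st(2), of j i]] by simp
    moreover have "?s p * ?m k i p * (?s q * ?m j k q) = ?s p * (?s q * (?m k i p * ?m j k q))"
      by (simp only: ac_simps)
    ultimately show "val_le (?s p * ?m k i p * (?s q * ?m j k q))
        (elt_det A * elt_det (replace_row A j (A $ i)))"
      by (simp only: val_le_layer)
  qed
qed

section \<open>Quasi-identities\<close>

text \<open>
  Contracting along a cycle of \<open>p\<close> with the triangle inequality ends in a diagonal entry. The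
  induction removes one point \<open>x\<close> at a time: the two factors at \<open>x\<close> and at its preimage \<open>y\<close> are
  replaced by the shortcut from \<open>y\<close> to \<open>p x\<close>.
\<close>

lemma val_le_prod_permutation:
  assumes "finite S" "p permutes S"
    and tri: "\<And>i j k. val_le (E $ i $ k * E $ k $ j) (E $ i $ j)"
    and diag: "\<And>i. E $ i $ i = 1"
  shows "val_le (\<Prod>i\<in>S. E $ i $ p i) 1"
  using assms(1,2)
proof (induction S arbitrary: p rule: finite_induct)
  case empty
  then show ?case by (simp add: val_le_refl)
next
  case (insert x S)
  let ?q = "Transposition.transpose x (p x) \<circ> p"
  have q: "?q permutes S" using insert.prems by (rule permutes_insert_lemma)
  have inj: "inj p" using insert.prems by (rule permutes_inj)
  have IH: "val_le (\<Prod>i\<in>S. E $ i $ ?q i) 1" using insert.IH[OF q] .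
  show ?case
  proof (cases "p x = x")
    case True
    then show ?thesis using insert IH diag by simp
  next
    case False
    define y where "y = inv p x"
    have py: "p y = x" unfolding y_def using permutes_inverses[OF insert.prems] by simp
    have "y \<noteq> x" using py False by auto
    then have y: "y \<in> S"
      using py permutes_not_in[OF insert.prems, of y] by auto
    have q_other: "?q i = p i" if "i \<in> S - {y}" for i
    proof -
      have "p i \<noteq> x" using that py inj by (auto dest: injD)
      moreover have "p i \<noteq> p x" using that insert.hyps inj by (auto dest: injD)
      ultimately show ?thesis by (simp add: Transposition.transpose_def)
    qed
    let ?R = "\<Prod>i\<in>S - {y}. E $ i $ p i"
    have "(\<Prod>i\<in>insert x S. E $ i $ p i) = E $ y $ x * E $ x $ p x * ?R"
      using insert.hyps prod.remove[OF insert.hyps(1) y, of "\<lambda>i. E $ i $ p i"] py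
      by (simp add: ac_simps)
    moreover have "(\<Prod>i\<in>S. E $ i $ ?q i) = E $ y $ p x * ?R"
      using prod.remove[OF insert.hyps(1) y, of "\<lambda>i. E $ i $ ?q i"] py q_other by simp
    moreover have "val_le (E $ y $ x * E $ x $ p x * ?R) (E $ y $ p x * ?R)"
      by (rule val_le_mult_right[OF tri])
    ultimately show ?thesis
      using IH by (simp only: val_le_trans)
  qed
qed

text \<open>
  In both sums that have to be evaluated, one term is the expected result and each of the others
  contains an off-diagonal factor, hence has layer \<open>0\<close>, and is bounded in value by
  that term. In particular \<open>det E = 1\<close>, which is more than nonsingularity.
\<close>

lemma quasi_identityI:
  fixes E :: "('l::comm_ring_1, 'f::linordered_ab_group_add) elt ^'n^'n"
  assumes tri: "\<And>i j k. val_le (E $ i $ k * E $ k $ j) (E $ i $ j)"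
    and diag: "\<And>i. E $ i $ i = 1"
    and off: "\<And>i j. i \<noteq> j \<Longrightarrow> layer (E $ i $ j) = 0"
  shows "quasi_identity E"
proof -
  have "E ** E = E"
  proof -
    have "(\<Sum>k\<in>UNIV. E $ i $ k * E $ k $ j) = E $ i $ j" for i j
    proof -
      have "(\<Sum>k\<in>UNIV. E $ i $ k * E $ k $ j) =
          E $ i $ j + (\<Sum>k\<in>UNIV - {i}. E $ i $ k * E $ k $ j)"
        by (subst sum.remove[of _ i]) (simp_all add: diag)
      also have "\<dots> = E $ i $ j"
        by (intro absorb_sum layer_mult_eq_0 off tri) auto
      finally show ?thesis .
    qed
    then show ?thesis by (simp add: matrix_matrix_mult_def vec_eq_iff)
  qed
  moreover have "elt_det E = 1"
  proof -
    let ?P = "{p. p permutes (UNIV :: 'n set)}"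
    let ?t = "\<lambda>p. Elt (of_int (sign p)) 0 * (\<Prod>i\<in>UNIV. E $ i $ p i)"
    have "elt_det E = ?t id + (\<Sum>p\<in>?P - {id}. ?t p)"
      unfolding elt_det_def
      by (rule sum.remove) (simp_all add: finite_permutations permutes_id)
    also have "?t id = 1" by (simp add: diag sign_id flip: one_elt_def)
    also have "1 + (\<Sum>p\<in>?P - {id}. ?t p) = 1"
    proof (rule absorb_sum)
      fix p assume p: "p \<in> ?P - {id}"
      then obtain x where "p x \<noteq> x" by (auto simp: fun_eq_iff)
      then have "layer (E $ x $ p x) = 0" using off by metis
      then have "layer (E $ x $ p x * (Elt (of_int (sign p)) 0 * (\<Prod>i\<in>UNIV - {x}. E $ i $ p i))) = 0"
        by (rule layer_mult_eq_0)
      then show "layer (?t p) = 0"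
        by (subst prod.remove[of _ x]) (simp_all add: mult.left_commute)
      show "val_le (?t p) 1"
        unfolding val_le_layer using p by (intro val_le_prod_permutation tri diag) auto
    qed (simp add: finite_permutations)
    finally show ?thesis .
  qed
  ultimately show ?thesis
    unfolding quasi_identity_def elt_nonsingular_def using diag off by (auto simp: layer_one)
qed

lemma quasi_identity_transpose:
  assumes "quasi_identity E"
  shows "quasi_identity (transpose E)"
proof -
  have "transpose E ** transpose E = transpose (E ** E)"
    by (rule matrix_transpose_mul[symmetric])
  then show ?thesis
    using assms unfolding quasi_identity_def elt_nonsingular_def elt_det_transpose
    by (auto simp: transpose_nth)
qed

text \<open>
  The cofactors of row \<open>i\<close> are written as determinants of \<open>A\<close> with row \<open>i\<close> replaced by a unit
  vector, which avoids minors and hence index types of smaller cardinality.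
\<close>

definition scaled_adjugate ::
  "('l::comm_ring_1, 'f::linordered_ab_group_add) elt \<Rightarrow> ('l, 'f) elt ^'n^'n \<Rightarrow> ('l, 'f) elt ^'n^'n" where
  "scaled_adjugate u A = (\<chi> j i. u * elt_det (replace_row A i (axis j 1)))"

lemma quasi_identity_mult_scaled_adjugate:
  fixes A :: "('l::comm_ring_1, 'f::linordered_ab_group_add) elt ^'n^'n"
  assumes u: "elt_det A * u = 1"
  shows "quasi_identity (A ** scaled_adjugate u A)"
proof -
  let ?E = "A ** scaled_adjugate u A"
  have E: "?E $ i $ k = u * elt_det (replace_row A k (A $ i))" for i k
    unfolding elt_det_replace_row_expand[of A k "A $ i"]
    by (simp add: matrix_matrix_mult_def scaled_adjugate_def sum_distrib_left mult.left_commute)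
  show ?thesis
  proof (rule quasi_identityI)
    fix i show "?E $ i $ i = 1" unfolding E replace_row_self using u by (simp add: mult.commute)
  next
    fix i j :: 'n assume "i \<noteq> j"
    then have "layer (elt_det (replace_row A j (A $ i))) = 0"
      by (intro layer_elt_det_equal_rows[of i j]) (auto simp: replace_row_def)
    then show "layer (?E $ i $ j) = 0"
      unfolding E by (subst mult.commute) (rule layer_mult_eq_0)
  next
    fix i j k
    let ?d = "\<lambda>i k. elt_det (replace_row A k (A $ i))"
    have "?E $ i $ k * ?E $ k $ j = ?d i k * ?d k j * (u * u)"
      unfolding E by (simp only: ac_simps)
    \<comment> \<open>One factor \<open>u\<close> cancels against \<open>det A\<close>, which brings both sides to the form of
      \<open>val_le_elt_det_exchange\<close>.\<close>
    moreover have "?E $ i $ j = elt_det A * ?d i j * (u * u)"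
    proof -
      have "elt_det A * ?d i j * (u * u) = (elt_det A * u) * (u * ?d i j)" by (simp only: ac_simps)
      then show ?thesis unfolding E u by simp
    qed
    ultimately show "val_le (?E $ i $ k * ?E $ k $ j) (?E $ i $ j)"
      using val_le_mult_right[OF val_le_elt_det_exchange[of A k i j], of "u * u"] by simp
  qed
qed

lemma scaled_adjugate_transpose:
  "scaled_adjugate u (transpose A) = transpose (scaled_adjugate u A)"
  by (simp add: vec_eq_iff scaled_adjugate_def transpose_nth elt_det_unit_row_transpose)

theorem theorem2p26:
  fixes A :: "('l::comm_ring_1, 'f::linordered_ab_group_add) elt ^'n^'n"
  assumes "elt_invertible (elt_det A)"
  shows "quasi_invertible A"
proof -
  obtain u where u: "elt_det A * u = 1"
    using assms unfolding elt_invertible_def by blast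
  let ?B = "scaled_adjugate u A"
  have "quasi_identity (transpose A ** transpose ?B)"
    unfolding scaled_adjugate_transpose[symmetric]
    using u by (intro quasi_identity_mult_scaled_adjugate) (simp add: elt_det_transpose)
  then have "quasi_identity (transpose (transpose A ** transpose ?B))"
    by (rule quasi_identity_transpose)
  then have "quasi_identity (?B ** A)"
    by (simp add: matrix_transpose_mul)
  with quasi_identity_mult_scaled_adjugate[OF u] show ?thesis
    unfolding quasi_invertible_def quasi_inverse_def by blast
qed

end
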